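(* Let $R$ be a semiprime ring and let $D, G : R \to R$ be derivations. Then the mapping $R \to R$, $x \mapsto D(x) + G^2(x)$, where $G^2(x) = G(G(x))$, is a free action on $R$.
   Context: Rings are associative (not assumed unital or commutative). A ring $R$ is semiprime if, for $a \in R$, $aRa = (0)$ implies $a = 0$. A derivation of $R$ is an additive mapping $d : R \to R$ with $d(xy) = d(x)y + x d(y)$ for all $x, y \in R$. An element $a \in R$ is called a dependent element of a mapping $T : R \to R$ (or an element dependent on $T$) if $T(x)a = ax$ for all $x \in R$. A mapping $T : R \to R$ is called a free action on $R$ if $0$ is the only dependent element of $T$. *)

theory Defs
  imports Complex_Main
begin

(* The class ring assumes neither a unit nor commutativity of the multiplication. *)
class semiprime_ring = ring +
  assumes semiprime: "(\<forall>x. a * x * a = 0) \<Longrightarrow> a = 0"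

definition derivation :: "('a::ring \<Rightarrow> 'a) \<Rightarrow> bool" where
  "derivation d \<longleftrightarrow> additive d \<and> (\<forall>x y. d (x * y) = d x * y + x * d y)"

definition dependent_element :: "('a::ring \<Rightarrow> 'a) \<Rightarrow> 'a \<Rightarrow> bool" where
  "dependent_element T a \<longleftrightarrow> (\<forall>x. T x * a = a * x)"

definition free_action :: "('a::ring \<Rightarrow> 'a) \<Rightarrow> bool" where
  "free_action T \<longleftrightarrow> {a. dependent_element T a} = {0}"

end

theory Submission
  imports Defs
begin

text \<open>
  Write \<open>F x = D x + G (G x)\<close>. The map \<open>F\<close> fails to be a derivation only by a cross term:
  \<open>F (x * y) = F x * y + x * F y + 2 * G x * G y\<close>. Let \<open>a\<close> be dependent on \<open>F\<close>, so that
  \<open>F x * a = a * x\<close>. Evaluating \<open>F (x * y) * a\<close> in two ways removes \<open>F y\<close> and gives the identity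
  \<open>F x * y * a + 2 * G x * G y * a = (a * x - x * a) * y\<close>. Comparing its instance at \<open>y * a\<close> with
  the identity multiplied by \<open>a\<close> on the right isolates the derivative of \<open>a\<close>:
  \<open>2 * G x * y * G a * a = 0\<close>. Semiprimeness turns this into \<open>2 * G a * a = 0\<close>.
  The identity at \<open>y = a\<close> then loses its cross term and reduces to \<open>x * a * a = 0\<close>, so
  \<open>a * a = 0\<close>; finally \<open>a * x * a = F x * (a * a) = 0\<close>, and semiprimeness gives \<open>a = 0\<close>.

  The argument rests on the cross-term law with a derivation \<open>G\<close>, so it is carried out for an
  arbitrary map \<open>F\<close> obeying that law. As there is no unit, doubling is written as a repeated
  summand.
\<close>

lemma derivation_mult: "derivation d \<Longrightarrow> d (x * y) = d x * y + x * d y"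
  by (simp add: derivation_def)

lemma derivation_add: "derivation d \<Longrightarrow> d (x + y) = d x + d y"
  by (simp add: derivation_def additive.add)

lemma derivation_plus_square_mult:
  assumes D: "derivation D" and G: "derivation G"
  shows "D (x * y) + G (G (x * y)) =
    (D x + G (G x)) * y + x * (D y + G (G y)) + (G x * G y + G x * G y)"
  by (simp add: derivation_mult[OF D] derivation_mult[OF G] derivation_add[OF G] algebra_simps)

text \<open>
  This is \<open>F (x * y) * a\<close> computed as \<open>a * (x * y)\<close> and by the cross-term law; the summand
  \<open>x * F y * a\<close> becomes \<open>x * a * y\<close>, so no value of \<open>F\<close> at \<open>y\<close> survives.
\<close>
lemma dependent_element_identity:
  fixes F G :: "'a::ring \<Rightarrow> 'a"
  assumes F: "\<And>x y. F (x * y) = F x * y + x * F y + (G x * G y + G x * G y)"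
    and dep: "\<And>x. F x * a = a * x"
  shows "F x * y * a + (G x * G y * a + G x * G y * a) = a * x * y - x * a * y"
proof -
  have "a * (x * y) = F (x * y) * a"
    by (simp add: dep)
  also have "\<dots> = F x * y * a + x * (F y * a) + (G x * G y * a + G x * G y * a)"
    by (simp add: F algebra_simps)
  finally show ?thesis
    by (simp add: dep algebra_simps)
qed

lemma dependent_element_eq_0:
  fixes F G :: "'a::semiprime_ring \<Rightarrow> 'a"
  assumes F: "\<And>x y. F (x * y) = F x * y + x * F y + (G x * G y + G x * G y)"
    and G: "derivation G"
    and dep: "\<And>x. F x * a = a * x"
  shows "a = 0"
proof -
  note identity = dependent_element_identity[of F G a, OF F dep]
  let ?u = "G a * a + G a * a"
  have cross: "G x * y * G a * a + G x * y * G a * a = 0" for x y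
    \<comment> \<open>The two sides compared are the identity at \<open>y * a\<close> and the identity at \<open>y\<close> times \<open>a\<close>;
      by the product rule for \<open>G (y * a)\<close> they differ exactly by this expression.\<close>
  proof -
    have "F x * (y * a) * a + (G x * G (y * a) * a + G x * G (y * a) * a)
        = (F x * y * a + (G x * G y * a + G x * G y * a)) * a"
      unfolding identity by (simp add: algebra_simps)
    then show ?thesis
      by (simp add: derivation_mult[OF G] algebra_simps)
  qed
  have "?u * y * ?u = 0" for y
  proof -
    have "?u * y * ?u = (G a * (a * y) * G a * a + G a * (a * y) * G a * a)
        + (G a * (a * y) * G a * a + G a * (a * y) * G a * a)"
      by (simp add: algebra_simps)
    then show ?thesis
      by (simp only: cross add_0_left)
  qed
  then have u: "?u = 0"
    using semiprime by blast
  have right_ann: "x * (a * a) = 0" for x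
  proof -
    have "G x * G a * a + G x * G a * a = G x * ?u"
      by (simp add: algebra_simps)
    then have "F x * a * a = a * x * a - x * a * a"
      using identity[of x a] by (simp add: u)
    then show ?thesis
      by (simp add: dep algebra_simps)
  qed
  then have square: "a * a = 0"
    using semiprime[of "a * a"] by simp
  have "a * x * a = 0" for x
  proof -
    have "a * x * a = F x * (a * a)"
      by (simp add: dep flip: mult.assoc)
    then show ?thesis
      by (simp add: square)
  qed
  then show ?thesis
    using semiprime by blast
qed

theorem theorem2p1:
  fixes D G :: "'a::semiprime_ring \<Rightarrow> 'a"
  assumes "derivation D" and "derivation G"
  shows "free_action (\<lambda>x. D x + G (G x))"
proof -
  have "a = 0" if "dependent_element (\<lambda>x. D x + G (G x)) a" for a
  proof (rule dependent_element_eq_0[of "\<lambda>x. D x + G (G x)" G])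
    show "derivation G"
      by fact
  qed (use that derivation_plus_square_mult[OF assms] in \<open>simp_all add: dependent_element_def\<close>)
  moreover have "dependent_element (\<lambda>x. D x + G (G x)) 0"
    by (simp add: dependent_element_def)
  ultimately show ?thesis
    by (auto simp: free_action_def)
qed

end
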